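(* Let $n$ be a positive integer, let $1>p_1\geq p_2\geq\cdots\geq p_n>0$ be real numbers, and let $\boldsymbol p=(p_1,p_2,\ldots,p_n)$. Let $p_3<\frac12$. Suppose that $p_1\leq\frac12$ or $1-p_2>p_3$. If $\mathcal A\subset 2^{[n]}$ is a $2$-wise intersecting family, then $\mu_{\boldsymbol p}(\mathcal A)\leq p_1$. Moreover, equality holds if and only if $\mathcal A$ is a star centered at some $i\in[n]$ with $p_1=p_i$.
   Context: $[n]=\{1,2,\ldots,n\}$ and $2^{[n]}$ is the family of all subsets of $[n]$. A family $\mathcal A\subset 2^{[n]}$ is $r$-wise intersecting if $A_1\cap A_2\cap\cdots\cap A_r\neq\emptyset$ for all (not necessarily distinct) $A_1,\ldots,A_r\in\mathcal A$. For $\boldsymbol p=(p_1,\ldots,p_n)\in(0,1)^n$ and $A\subset[n]$, $\mu_{\boldsymbol p}(A):=\prod_{i\in A}p_i\prod_{j\in[n]\setminus A}(1-p_j)$, and for a family $\mathcal A\subset 2^{[n]}$, $\mu_{\boldsymbol p}(\mathcal A):=\sum_{A\in\mathcal A}\mu_{\boldsymbol p}(A)$. The star centered at $i\in[n]$ is the family $\{A\in 2^{[n]}: i\in A\}$. For $n\leq 2$, the conditions that mention $p_i$ with $i>n$ are read as vacuous. *)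

theory Defs
  imports Complex_Main
begin

text \<open>The ground set \<open>[n]\<close> is \<open>{1..n}\<close>. A weight vector is a function
  \<open>p :: nat \<Rightarrow> real\<close> of which only the values on \<open>{1..n}\<close> are used.\<close>

text \<open>The sets \<open>B 1, ..., B r\<close> need not be distinct.\<close>

definition wise_intersecting :: "nat \<Rightarrow> 'a set set \<Rightarrow> bool" where
  "wise_intersecting r \<A> \<longleftrightarrow>
     (\<forall>B :: nat \<Rightarrow> 'a set. (\<forall>k\<in>{1..r}. B k \<in> \<A>) \<longrightarrow> (\<Inter>k\<in>{1..r}. B k) \<noteq> {})"

definition mu_set :: "nat \<Rightarrow> (nat \<Rightarrow> real) \<Rightarrow> nat set \<Rightarrow> real" where
  "mu_set n p A = (\<Prod>i\<in>A. p i) * (\<Prod>j\<in>{1..n} - A. 1 - p j)"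

definition mu :: "nat \<Rightarrow> (nat \<Rightarrow> real) \<Rightarrow> nat set set \<Rightarrow> real" where
  "mu n p \<A> = (\<Sum>A\<in>\<A>. mu_set n p A)"

definition star :: "nat \<Rightarrow> nat \<Rightarrow> nat set set" where
  "star n i = {A \<in> Pow {1..n}. i \<in> A}"

end

theory Submission
  imports Defs
begin

text \<open>
  The proof is an induction on \<open>n\<close> along the last element. For \<open>n \<le> 2\<close> every intersecting family
  lies inside a star, and a star centered at \<open>i\<close> has measure \<open>p i\<close>
  (\<open>intersecting_on_two_sub_star\<close>, \<open>mu_star\<close>), which is at most \<open>p 1\<close>.

  For the step from \<open>m\<close> to \<open>m + 1 \<ge> 3\<close> split \<open>\<A>\<close> into the family \<open>\<A>0\<close> of members avoiding
  \<open>m + 1\<close> and the link \<open>\<A>1\<close> of \<open>m + 1\<close>, both on \<open>{1..m}\<close>. Then \<open>mu\<close> of \<open>\<A>\<close> is the average of the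
  measures of \<open>\<A>0\<close> and \<open>\<A>1\<close> with coefficients \<open>1 - p (m + 1)\<close> and \<open>p (m + 1)\<close>
  (\<open>mu_Suc\<close>). If both were intersecting, the induction hypothesis would bound the average by \<open>p 1\<close>.
  The family \<open>\<A>0\<close> is intersecting, and each of its members meets each member of \<open>\<A>1\<close>, but two members of \<open>\<A>1\<close>
  may be disjoint. Two ideas repair this.

  Compression. Replacing \<open>m + 1\<close> by a smaller \<open>i\<close> in members of \<open>\<A>\<close>, whenever the result is new,
  keeps the family intersecting and does not decrease its measure because \<open>p i \<ge> p (m + 1)\<close>
  (\<open>intersecting_shift\<close>, \<open>mu_shift_ge\<close>). Once no such move is possible, disjoint members
  of \<open>\<A>1\<close> must be complementary in \<open>{1..m}\<close>: an element missed by both could replace \<open>m + 1\<close> in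
  one of them (\<open>disjoint_links_complementary\<close>).

  Exchange. From each complementary pair in \<open>\<A>1\<close> delete the lighter set and add the heavier one to
  \<open>\<A>0\<close>. Both families are then intersecting, and as \<open>p (m + 1) < 1/2\<close> the average
  strictly increases unless there is no such pair (\<open>compressed_extremal\<close>).

  Equality survives all of this. In a compressed family it forces \<open>\<A>0\<close> and \<open>\<A>1\<close> to be stars, with
  the same center because \<open>\<A>0\<close> and \<open>\<A>1\<close> cross-intersect; and a family whose compression is a star
  was itself a star (\<open>star_if_shift_star\<close>).
\<close>

section \<open>Intersecting families and the product measure\<close>

definition intersecting :: "'a set set \<Rightarrow> bool" where
  "intersecting \<A> \<longleftrightarrow> (\<forall>F\<in>\<A>. \<forall>G\<in>\<A>. F \<inter> G \<noteq> {})"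

lemma intersectingI: "(\<And>F G. F \<in> \<A> \<Longrightarrow> G \<in> \<A> \<Longrightarrow> F \<inter> G \<noteq> {}) \<Longrightarrow> intersecting \<A>"
  by (auto simp: intersecting_def)

lemma intersectingD: "intersecting \<A> \<Longrightarrow> F \<in> \<A> \<Longrightarrow> G \<in> \<A> \<Longrightarrow> F \<inter> G \<noteq> {}"
  by (auto simp: intersecting_def)

lemma intersecting_if_wise_intersecting_2:
  assumes "wise_intersecting 2 \<A>"
  shows "intersecting \<A>"
proof (rule intersectingI)
  fix F G assume FG: "F \<in> \<A>" "G \<in> \<A>"
  define B where "B = (\<lambda>k::nat. if k = 1 then F else G)"
  have "{1..2::nat} = {1,2}" by auto
  then have "(\<Inter>k\<in>{1..2}. B k) = F \<inter> G" by (auto simp: B_def)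
  moreover have "\<forall>k\<in>{1..2}. B k \<in> \<A>" using FG by (simp add: B_def)
  ultimately show "F \<inter> G \<noteq> {}" using assms unfolding wise_intersecting_def by metis
qed

lemma finite_family: "\<A> \<subseteq> Pow {1..n::nat} \<Longrightarrow> finite \<A>"
  by (meson finite_Pow_iff finite_atLeastAtMost finite_subset)

lemma mu_set_pos:
  assumes "\<forall>i\<in>{1..n}. 0 < p i \<and> p i < 1" "F \<subseteq> {1..n}"
  shows "0 < mu_set n p F"
  unfolding mu_set_def using assms
  by (intro mult_pos_pos prod_pos ballI) (simp_all add: subset_iff)

lemma mu_nonneg:
  assumes "\<forall>i\<in>{1..n}. 0 < p i \<and> p i < 1" "\<A> \<subseteq> Pow {1..n}"
  shows "0 \<le> mu n p \<A>"
  unfolding mu_def using assms by (intro sum_nonneg less_imp_le[OF mu_set_pos]) (assumption | rule subsetD[THEN PowD])+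

lemma mu_eq_0_iff:
  assumes "\<forall>i\<in>{1..n}. 0 < p i \<and> p i < 1" "\<A> \<subseteq> Pow {1..n}"
  shows "mu n p \<A> = 0 \<longleftrightarrow> \<A> = {}"
proof
  assume "mu n p \<A> = 0"
  moreover have "\<And>F. F \<in> \<A> \<Longrightarrow> 0 < mu_set n p F"
    using assms by (intro mu_set_pos) auto
  ultimately show "\<A> = {}"
    unfolding mu_def using finite_family[OF assms(2)] by (metis less_irrefl sum_pos)
qed (simp add: mu_def)

lemma mu_Un_disjoint:
  "\<A> \<subseteq> Pow {1..n} \<Longrightarrow> \<B> \<subseteq> Pow {1..n} \<Longrightarrow> \<A> \<inter> \<B> = {} \<Longrightarrow> mu n p (\<A> \<union> \<B>) = mu n p \<A> + mu n p \<B>"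
  unfolding mu_def by (intro sum.union_disjoint finite_family)

lemma mu_Diff_subset:
  assumes "\<A> \<subseteq> Pow {1..n}" "\<B> \<subseteq> \<A>"
  shows "mu n p (\<A> - \<B>) = mu n p \<A> - mu n p \<B>"
  unfolding mu_def using assms finite_family by (intro sum_diff) auto

lemma mu_set_Suc:
  assumes "F \<subseteq> {1..m}"
  shows "mu_set (Suc m) p F = (1 - p (Suc m)) * mu_set m p F"
    and "mu_set (Suc m) p (insert (Suc m) F) = p (Suc m) * mu_set m p F"
proof -
  have "{1..Suc m} - F = insert (Suc m) ({1..m} - F)" "{1..Suc m} - insert (Suc m) F = {1..m} - F"
    "Suc m \<notin> F" "finite F"
    using assms by (auto intro: finite_subset)
  then show "mu_set (Suc m) p F = (1 - p (Suc m)) * mu_set m p F"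
    and "mu_set (Suc m) p (insert (Suc m) F) = p (Suc m) * mu_set m p F"
    by (simp_all add: mu_set_def)
qed

definition avoiding :: "nat \<Rightarrow> nat set set \<Rightarrow> nat set set" where
  "avoiding x \<A> = {F \<in> \<A>. x \<notin> F}"

definition link :: "nat \<Rightarrow> nat set set \<Rightarrow> nat set set" where
  "link x \<A> = {F. x \<notin> F \<and> insert x F \<in> \<A>}"

lemma avoiding_link_subset:
  assumes "\<A> \<subseteq> Pow {1..Suc m}"
  shows "avoiding (Suc m) \<A> \<subseteq> Pow {1..m}" "link (Suc m) \<A> \<subseteq> Pow {1..m}"
  using assms unfolding avoiding_def link_def
  by (fastforce simp: atLeastAtMostSuc_conv)+

lemma avoiding_Un_link: "\<A> = avoiding x \<A> \<union> insert x ` link x \<A>"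
proof
  show "\<A> \<subseteq> avoiding x \<A> \<union> insert x ` link x \<A>"
  proof
    fix F assume F: "F \<in> \<A>"
    show "F \<in> avoiding x \<A> \<union> insert x ` link x \<A>"
    proof (cases "x \<in> F")
      case True
      then have "F = insert x (F - {x})" "F - {x} \<in> link x \<A>"
        using F by (auto simp: link_def insert_absorb)
      then show ?thesis by blast
    qed (use F in \<open>auto simp: avoiding_def\<close>)
  qed
qed (auto simp: avoiding_def link_def)

lemma mu_Suc:
  assumes "\<A> \<subseteq> Pow {1..Suc m}"
  shows "mu (Suc m) p \<A> = (1 - p (Suc m)) * mu m p (avoiding (Suc m) \<A>)
    + p (Suc m) * mu m p (link (Suc m) \<A>)"
proof -
  let ?x = "Suc m"
  note sub = avoiding_link_subset[OF assms]
  have inj: "inj_on (insert ?x) (link ?x \<A>)"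
    by (rule inj_on_inverseI[where g = "\<lambda>F. F - {?x}"]) (simp add: link_def)
  have "mu ?x p \<A> = mu ?x p (avoiding ?x \<A>) + mu ?x p (insert ?x ` link ?x \<A>)"
    using mu_Un_disjoint[of "avoiding ?x \<A>" ?x "insert ?x ` link ?x \<A>" p]
      avoiding_Un_link[of \<A> ?x] assms by (fastforce simp: avoiding_def link_def)
  also have "mu ?x p (avoiding ?x \<A>) = (1 - p ?x) * mu m p (avoiding ?x \<A>)"
    unfolding mu_def sum_distrib_left using sub(1)
    by (intro sum.cong refl mu_set_Suc) auto
  also have "mu ?x p (insert ?x ` link ?x \<A>) = p ?x * mu m p (link ?x \<A>)"
    unfolding mu_def sum_distrib_left sum.reindex[OF inj] o_def using sub(2)
    by (intro sum.cong refl mu_set_Suc) auto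
  finally show ?thesis .
qed

section \<open>Stars\<close>

lemma mu_Pow: "mu n p (Pow {1..n}) = 1"
proof (induction n)
  case 0
  show ?case by (simp add: mu_def mu_set_def)
next
  case (Suc m)
  have "avoiding (Suc m) (Pow {1..Suc m}) = Pow {1..m}" "link (Suc m) (Pow {1..Suc m}) = Pow {1..m}"
    by (auto simp: avoiding_def link_def atLeastAtMostSuc_conv)
  then show ?case using mu_Suc[of "Pow {1..Suc m}" m p] Suc by simp
qed

lemma star_Suc:
  assumes "i \<in> {1..m}"
  shows "avoiding (Suc m) (star (Suc m) i) = star m i" "link (Suc m) (star (Suc m) i) = star m i"
  using assms by (auto simp: star_def avoiding_def link_def atLeastAtMostSuc_conv)

lemma mu_star: "i \<in> {1..n} \<Longrightarrow> mu n p (star n i) = p i"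
proof (induction n)
  case (Suc m)
  have sub: "star (Suc m) i \<subseteq> Pow {1..Suc m}" by (auto simp: star_def)
  show ?case
  proof (cases "i = Suc m")
    case True
    have "avoiding (Suc m) (star (Suc m) i) = {}" "link (Suc m) (star (Suc m) i) = Pow {1..m}"
      using True by (auto simp: star_def avoiding_def link_def atLeastAtMostSuc_conv)
    moreover have "mu m p {} = 0" by (simp add: mu_def)
    ultimately show ?thesis using mu_Suc[OF sub, of p] True mu_Pow[of m p] by simp
  next
    case False
    then have i: "i \<in> {1..m}" using Suc.prems by auto
    show ?thesis using mu_Suc[OF sub, of p] star_Suc[OF i] Suc.IH[OF i]
      by (simp add: algebra_simps)
  qed
qed simp

text \<open>The form in which the bound is carried through the induction: equality forces some star,
  and the weight of its center is then determined by \<open>mu_star\<close>.\<close>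

definition extremal_bound :: "nat \<Rightarrow> (nat \<Rightarrow> real) \<Rightarrow> nat set set \<Rightarrow> bool" where
  "extremal_bound n p \<A> \<longleftrightarrow>
     mu n p \<A> \<le> p 1 \<and> (mu n p \<A> = p 1 \<longrightarrow> (\<exists>i\<in>{1..n}. \<A> = star n i))"

lemma sub_star_extremal:
  assumes p01: "\<forall>i\<in>{1..n}. 0 < p i \<and> p i < 1"
    and i: "i \<in> {1..n}" "p i \<le> p 1" and sub: "\<A> \<subseteq> star n i"
  shows "extremal_bound n p \<A>"
proof -
  have s: "star n i \<subseteq> Pow {1..n}" by (auto simp: star_def)
  have eq: "mu n p (star n i - \<A>) = p i - mu n p \<A>"
    using mu_Diff_subset[OF s sub, of p] mu_star[OF i(1), of p] by simp
  have s': "star n i - \<A> \<subseteq> Pow {1..n}" using s by blast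
  have nn: "0 \<le> mu n p (star n i - \<A>)" by (rule mu_nonneg[OF p01 s'])
  have "\<A> = star n i" if "mu n p \<A> = p 1"
  proof -
    have "mu n p (star n i - \<A>) = 0" using that eq nn i(2) by linarith
    then have "star n i - \<A> = {}" using mu_eq_0_iff[OF p01 s'] by simp
    then show ?thesis using sub by blast
  qed
  moreover have "mu n p \<A> \<le> p 1" using eq nn i(2) by linarith
  ultimately show ?thesis unfolding extremal_bound_def using i(1) by blast
qed

lemma sub_star_if_singleton:
  assumes "intersecting \<A>" "\<A> \<subseteq> Pow {1..n}" "{i} \<in> \<A>"
  shows "\<A> \<subseteq> star n i"
  using assms intersectingD[OF assms(1) assms(3)] by (auto simp: star_def)

lemma intersecting_on_two_sub_star:
  assumes "intersecting \<A>" "\<A> \<subseteq> Pow {1..n}" "n = 1 \<or> n = 2"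
  shows "\<exists>i\<in>{1..n}. \<A> \<subseteq> star n i"
proof (cases "{1} \<in> \<A>")
  case True
  then show ?thesis using sub_star_if_singleton[OF assms(1,2) True] assms(3) by force
next
  case False
  have "{} \<notin> \<A>" using intersectingD[OF assms(1)] by blast
  have "n \<in> F" if F: "F \<in> \<A>" for F
  proof (rule ccontr)
    assume n: "n \<notin> F"
    have "F \<subseteq> {1}"
    proof
      fix x assume x: "x \<in> F"
      then have "x \<in> {1..n}" "x \<noteq> n" using F assms(2) n by blast+
      then show "x \<in> {1}" using assms(3) by auto
    qed
    then have "F = {} \<or> F = {1}" by auto
    then show False using F False \<open>{} \<notin> \<A>\<close> by blast
  qed
  then have "\<A> \<subseteq> star n n" using assms(2) by (auto simp: star_def)
  then show ?thesis using assms(3) by (intro bexI[of _ n]) auto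
qed

section \<open>Shifting the last element\<close>

definition swap :: "'a \<Rightarrow> 'a \<Rightarrow> 'a set \<Rightarrow> 'a set" where
  "swap i j F = insert i (F - {j})"

definition movable :: "'a \<Rightarrow> 'a \<Rightarrow> 'a set set \<Rightarrow> 'a set set" where
  "movable i j \<A> = {F \<in> \<A>. j \<in> F \<and> i \<notin> F \<and> swap i j F \<notin> \<A>}"

definition shift :: "'a \<Rightarrow> 'a \<Rightarrow> 'a set set \<Rightarrow> 'a set set" where
  "shift i j \<A> = (\<A> - movable i j \<A>) \<union> swap i j ` movable i j \<A>"

lemma inj_on_swap: "inj_on (swap i j) {F. j \<in> F \<and> i \<notin> F}"
  by (rule inj_on_inverseI[where g = "swap j i"]) (auto simp: swap_def)

text \<open>The only dangerous pair is a swapped set and an unmoved \<open>G\<close> that met the original only in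
  \<open>j\<close>. As \<open>G\<close> contains \<open>j\<close> and not \<open>i\<close> but did not move, its own swap was already present, and that
  swap misses the original.\<close>

lemma intersecting_shift:
  assumes int: "intersecting \<A>" and "i \<noteq> j"
  shows "intersecting (shift i j \<A>)"
proof -
  have mixed: "swap i j F \<inter> G \<noteq> {}" if F: "F \<in> movable i j \<A>" and G: "G \<in> \<A> - movable i j \<A>" for F G
  proof
    assume e: "swap i j F \<inter> G = {}"
    have Fp: "F \<in> \<A>" "j \<in> F" "i \<notin> F" using F by (auto simp: movable_def)
    have "F \<inter> G \<noteq> {}" using intersectingD[OF int] Fp G by blast
    then have "j \<in> G" "i \<notin> G" using e by (auto simp: swap_def)
    then have "swap i j G \<in> \<A>" using G by (auto simp: movable_def)
    then have "F \<inter> swap i j G \<noteq> {}" using intersectingD[OF int] Fp by blast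
    then show False using e Fp by (auto simp: swap_def)
  qed
  show ?thesis
  proof (rule intersectingI)
    fix F G assume "F \<in> shift i j \<A>" "G \<in> shift i j \<A>"
    then consider "F \<in> \<A>" "G \<in> \<A>"
      | F' where "F = swap i j F'" "F' \<in> movable i j \<A>" "G \<in> \<A> - movable i j \<A>"
      | G' where "G = swap i j G'" "G' \<in> movable i j \<A>" "F \<in> \<A> - movable i j \<A>"
      | F' G' where "F = swap i j F'" "G = swap i j G'"
      unfolding shift_def by blast
    then show "F \<inter> G \<noteq> {}"
    proof cases
      case 1
      then show ?thesis by (rule intersectingD[OF int])
    next
      case 2
      then show ?thesis using mixed by blast
    next
      case 3
      then show ?thesis using mixed[of G' F] by (simp add: Int_commute)
    next
      case 4
      then show ?thesis by (auto simp: swap_def)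
    qed
  qed
qed

lemma shift_subset_Pow:
  assumes "\<A> \<subseteq> Pow X" "i \<in> X"
  shows "shift i j \<A> \<subseteq> Pow X"
  using assms by (fastforce simp: shift_def movable_def swap_def)

lemma mu_set_swap_ge:
  assumes p01: "\<forall>i\<in>{1..n}. 0 < p i \<and> p i < 1"
    and ij: "i \<in> {1..n}" "j \<in> {1..n}" "p j \<le> p i"
    and F: "F \<subseteq> {1..n}" "j \<in> F" "i \<notin> F"
  shows "mu_set n p F \<le> mu_set n p (swap i j F)"
proof -
  \<comment> \<open>Only the factors at \<open>i\<close> and \<open>j\<close> change; \<open>R\<close> is the common rest.\<close>
  define K where "K = F - {j}"
  define L where "L = {1..n} - F - {i}"
  define R where "R = (\<Prod>k\<in>K. p k) * (\<Prod>k\<in>L. 1 - p k)"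
  have fin: "finite K" "finite L" using F finite_subset by (auto simp: K_def L_def)
  have e: "F = insert j K" "j \<notin> K" "{1..n} - F = insert i L" "i \<notin> L"
    "swap i j F = insert i K" "i \<notin> K" "{1..n} - swap i j F = insert j L" "j \<notin> L"
    using F ij by (auto simp: K_def L_def swap_def)
  have "0 \<le> R" unfolding R_def using p01 F
    by (intro mult_nonneg_nonneg prod_nonneg) (force simp: K_def L_def intro: less_imp_le)+
  moreover have "mu_set n p F = p j * (1 - p i) * R"
    unfolding mu_set_def e(3) unfolding e(1) R_def using e fin by simp
  moreover have "mu_set n p (swap i j F) = p i * (1 - p j) * R"
    unfolding mu_set_def e(7) unfolding e(5) R_def using e fin by simp
  moreover have "p j * (1 - p i) \<le> p i * (1 - p j)" using ij by (simp add: algebra_simps)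
  ultimately show ?thesis by (simp add: mult_right_mono)
qed

lemma mu_shift_ge:
  assumes p01: "\<forall>i\<in>{1..n}. 0 < p i \<and> p i < 1"
    and ij: "i \<in> {1..n}" "j \<in> {1..n}" "p j \<le> p i" and sub: "\<A> \<subseteq> Pow {1..n}"
  shows "mu n p \<A> \<le> mu n p (shift i j \<A>)"
proof -
  let ?M = "movable i j \<A>"
  have M: "?M \<subseteq> \<A>" "swap i j ` ?M \<inter> \<A> = {}" "?M \<subseteq> {F. j \<in> F \<and> i \<notin> F}"
    by (auto simp: movable_def)
  have "shift i j \<A> \<subseteq> Pow {1..n}" using shift_subset_Pow sub ij(1) .
  then have "mu n p (shift i j \<A>) = mu n p (\<A> - ?M) + mu n p (swap i j ` ?M)"
    unfolding shift_def using M sub by (intro mu_Un_disjoint) auto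
  also have "mu n p (\<A> - ?M) = mu n p \<A> - mu n p ?M"
    using mu_Diff_subset[OF sub M(1)] .
  also have "mu n p (swap i j ` ?M) = (\<Sum>F\<in>?M. mu_set n p (swap i j F))"
    unfolding mu_def using sum.reindex[OF inj_on_subset[OF inj_on_swap M(3)]] by simp
  finally have "mu n p (shift i j \<A>) = mu n p \<A> - mu n p ?M + (\<Sum>F\<in>?M. mu_set n p (swap i j F))" .
  moreover have "mu n p ?M \<le> (\<Sum>F\<in>?M. mu_set n p (swap i j F))"
    unfolding mu_def using M(1,3) sub ij
    by (intro sum_mono mu_set_swap_ge[OF p01]) blast+
  ultimately show ?thesis by simp
qed

text \<open>Each effective shift away from \<open>j\<close> lowers the number of members containing \<open>j\<close>, so repeated
  shifting stops.\<close>

lemma card_containing_shift_less: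
  assumes "finite \<A>" "movable i j \<A> \<noteq> {}" "i \<noteq> j"
  shows "card {F \<in> shift i j \<A>. j \<in> F} < card {F \<in> \<A>. j \<in> F}"
proof (rule psubset_card_mono)
  show "finite {F \<in> \<A>. j \<in> F}" using assms(1) by simp
  have "{F \<in> shift i j \<A>. j \<in> F} = {F \<in> \<A>. j \<in> F} - movable i j \<A>"
    using assms(3) by (auto simp: shift_def swap_def)
  then show "{F \<in> shift i j \<A>. j \<in> F} \<subset> {F \<in> \<A>. j \<in> F}"
    using assms(2) by (auto simp: movable_def)
qed

text \<open>A moved set is absent from the shifted family, so a star obtained by an effective shift is
  centered at \<open>i\<close>. The origin of its member \<open>{i}\<close> decides: either \<open>{i}\<close> was in \<open>\<A>\<close>, and
  nothing can have moved, or it comes from \<open>{j}\<close>, so that all of \<open>\<A>\<close> contains \<open>j\<close>.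
  Conversely each set containing \<open>j\<close> is in \<open>\<A>\<close>: if it contains \<open>i\<close> it is in the shifted family
  and cannot be the result of a move, otherwise its swap is there and was not in \<open>\<A>\<close>.\<close>

lemma star_if_shift_star:
  assumes int: "intersecting \<A>" and sub: "\<A> \<subseteq> Pow {1..n}"
    and ij: "i \<in> {1..n}" "j \<in> {1..n}" "i \<noteq> j"
    and mov: "movable i j \<A> \<noteq> {}" and st: "shift i j \<A> = star n l"
  shows "\<A> = star n j"
proof -
  let ?M = "movable i j \<A>"
  have absent: "F \<notin> shift i j \<A>" if "F \<in> ?M" for F
    using that by (auto simp: shift_def movable_def swap_def)
  obtain F0 where F0: "F0 \<in> ?M" using mov by blast
  have F0': "F0 \<in> \<A>" "i \<notin> F0" using F0 by (auto simp: movable_def)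
  have "swap i j F0 \<in> star n l" using F0 st by (auto simp: shift_def)
  moreover have "F0 \<notin> star n l" using absent[OF F0] st by simp
  ultimately have "l = i" using F0' sub by (auto simp: star_def swap_def)
  have "{i} \<notin> \<A>" using intersectingD[OF int F0'(1)] F0'(2) by blast
  moreover have "{i} \<in> shift i j \<A>" using st ij \<open>l = i\<close> by (simp add: star_def)
  ultimately obtain F where F: "F \<in> ?M" "{i} = swap i j F" by (auto simp: shift_def)
  have "F = {j}" using F by (auto simp: movable_def swap_def)
  then have "{j} \<in> \<A>" using F by (simp add: movable_def)
  then have le: "\<A> \<subseteq> star n j" by (rule sub_star_if_singleton[OF int sub])
  have "G \<in> \<A>" if G: "G \<in> star n j" for G
  proof (cases "i \<in> G")
    case True
    then have "G \<in> shift i j \<A>" using G st \<open>l = i\<close> by (simp add: star_def)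
    moreover have "G \<notin> swap i j ` ?M" using G ij by (auto simp: star_def swap_def)
    ultimately show ?thesis by (auto simp: shift_def)
  next
    case False
    have jG: "j \<in> G" using G by (simp add: star_def)
    have "swap i j G \<in> star n i" using G ij by (auto simp: star_def swap_def)
    moreover have "swap i j G \<notin> \<A>" using le ij by (auto simp: star_def swap_def)
    ultimately obtain H where H: "H \<in> ?M" "swap i j G = swap i j H"
      using st \<open>l = i\<close> by (auto simp: shift_def)
    then have "G = H" using inj_on_swap[of i j] jG False
      by (auto simp: movable_def inj_on_def)
    then show ?thesis using H by (simp add: movable_def)
  qed
  then show ?thesis using le by blast
qed

section \<open>Families that cannot be shifted further\<close>

lemma disjoint_links_complementary:
  assumes int: "intersecting \<A>" and sub: "\<A> \<subseteq> Pow {1..Suc m}"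
    and compressed: "\<And>i. i \<in> {1..m} \<Longrightarrow> movable i (Suc m) \<A> = {}"
    and FG: "F \<in> link (Suc m) \<A>" "G \<in> link (Suc m) \<A>" "F \<inter> G = {}"
  shows "G = {1..m} - F"
proof -
  have FGm: "F \<subseteq> {1..m}" "G \<subseteq> {1..m}" using avoiding_link_subset(2)[OF sub] FG by auto
  have "i \<in> F \<union> G" if i: "i \<in> {1..m}" for i
  proof (rule ccontr)
    assume ni: "i \<notin> F \<union> G"
    have F': "insert (Suc m) F \<in> \<A>" "Suc m \<notin> F" using FG by (auto simp: link_def)
    have G': "insert (Suc m) G \<in> \<A>" "Suc m \<notin> G" using FG by (auto simp: link_def)
    have "swap i (Suc m) (insert (Suc m) F) = insert i F"
      using F' by (auto simp: swap_def)
    then have "insert i F \<in> \<A>"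
      using compressed[OF i] F' ni i by (auto simp: movable_def)
    then have "insert i F \<inter> insert (Suc m) G \<noteq> {}" using intersectingD[OF int] G' by blast
    then show False using ni FG(3) F' i by auto
  qed
  then show ?thesis using FGm FG(3) by blast
qed

text \<open>The exchange along complementary pairs. Write \<open>q\<close> for the weight of the last element and \<open>H\<close> for
  the collection of heavier halves. Adding \<open>H\<close> to the family of coefficient \<open>1 - q\<close> and deleting the
  complements from the family of coefficient \<open>q\<close> changes the average by
  \<open>(1 - q) * mu H - q * mu (c ` H)\<close>, which is at least \<open>(1 - 2 * q) * mu H\<close>.
  So equality is possible only for \<open>H = {}\<close>, when both families already are intersecting.\<close>

lemma compressed_extremal:
  assumes p01: "\<forall>i\<in>{1..Suc m}. 0 < p i \<and> p i < 1"
    and half: "p (Suc m) < 1/2" and m: "m \<ge> 1"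
    and IH: "\<And>\<B>. \<B> \<subseteq> Pow {1..m} \<Longrightarrow> intersecting \<B> \<Longrightarrow> extremal_bound m p \<B>"
    and int: "intersecting \<A>" and sub: "\<A> \<subseteq> Pow {1..Suc m}"
    and compressed: "\<And>i. i \<in> {1..m} \<Longrightarrow> movable i (Suc m) \<A> = {}"
  shows "extremal_bound (Suc m) p \<A>"
proof -
  define \<A>0 where "\<A>0 = avoiding (Suc m) \<A>"
  define \<A>1 where "\<A>1 = link (Suc m) \<A>"
  define c where "c = (\<lambda>F. {1..m} - F)"
  define w where "w = mu_set m p"
  \<comment> \<open>The heavier halves of the complementary pairs; membership of \<open>1\<close> breaks ties.\<close>
  define H where "H = {F \<in> \<A>1. c F \<in> \<A>1 \<and> (w (c F) < w F \<or> w (c F) = w F \<and> 1 \<in> F)}"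
  have sub0: "\<A>0 \<subseteq> Pow {1..m}" and sub1: "\<A>1 \<subseteq> Pow {1..m}"
    using avoiding_link_subset[OF sub] by (auto simp: \<A>0_def \<A>1_def)
  have HA: "H \<subseteq> \<A>1" "c ` H \<subseteq> \<A>1" by (auto simp: H_def)
  have cc: "c (c F) = F" if "F \<in> \<A>1" for F using that sub1 by (auto simp: c_def)
  have one: "1 \<in> c F \<longleftrightarrow> 1 \<notin> F" for F using m by (auto simp: c_def)
  have compl: "G = c F" if "F \<in> \<A>1" "G \<in> \<A>1" "F \<inter> G = {}" for F G
    using disjoint_links_complementary[OF int sub compressed] that by (simp add: \<A>1_def c_def)
  have cross: "F \<inter> G \<noteq> {}" if "F \<in> \<A>0" "G \<in> \<A>1" for F G
  proof -
    have "F \<in> \<A>" "Suc m \<notin> F" "insert (Suc m) G \<in> \<A>"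
      using that by (auto simp: \<A>0_def \<A>1_def avoiding_def link_def)
    then show ?thesis using intersectingD[OF int, of F "insert (Suc m) G"] by auto
  qed
  have not_both: "c F \<notin> H" if "F \<in> H" for F
  proof
    assume "c F \<in> H"
    then have "w F < w (c F) \<or> w F = w (c F) \<and> 1 \<in> c F"
      using cc[of F] that unfolding H_def mem_Collect_eq by metis
    moreover have "w (c F) < w F \<or> w (c F) = w F \<and> 1 \<in> F"
      using that unfolding H_def by blast
    ultimately show False using one[of F] by linarith
  qed
  have some: "F \<in> H \<or> c F \<in> H" if "F \<in> \<A>1" "c F \<in> \<A>1" for F
    using that cc[of F] one[of F] linorder_less_linear[of "w F" "w (c F)"]
    unfolding H_def mem_Collect_eq by metis
  have int0: "intersecting (\<A>0 \<union> H)"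
  proof (rule intersectingI)
    fix F G assume "F \<in> \<A>0 \<union> H" "G \<in> \<A>0 \<union> H"
    then consider "F \<in> \<A>0" "G \<in> \<A>0" | "F \<in> \<A>0" "G \<in> \<A>1" | "G \<in> \<A>0" "F \<in> \<A>1" | "F \<in> H" "G \<in> H"
      using HA(1) by blast
    then show "F \<inter> G \<noteq> {}"
    proof cases
      case 1
      then show ?thesis using intersectingD[OF int] by (simp add: \<A>0_def avoiding_def)
    next
      case 2
      then show ?thesis by (rule cross)
    next
      case 3
      then show ?thesis using cross[of G F] by (simp add: Int_commute)
    next
      case 4
      then have "G \<noteq> c F" using not_both by blast
      then show ?thesis using 4 compl[of F G] HA(1) by blast
    qed
  qed
  have int1: "intersecting (\<A>1 - c ` H)"
  proof (rule intersectingI)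
    fix F G assume FG: "F \<in> \<A>1 - c ` H" "G \<in> \<A>1 - c ` H"
    show "F \<inter> G \<noteq> {}"
    proof
      assume "F \<inter> G = {}"
      then have G: "G = c F" using FG compl by blast
      have "F = c G" using FG G cc by auto
      have "F \<notin> H" "G \<notin> H" using FG G \<open>F = c G\<close> by (metis DiffD2 imageI)+
      then show False using some[of F] FG G by simp
    qed
  qed
  let ?q = "p (Suc m)"
  have disj: "\<A>0 \<inter> H = {}"
  proof -
    have "False" if "F \<in> \<A>0" "F \<in> H" for F
      using cross[of F "c F"] that by (auto simp: H_def c_def)
    then show ?thesis by blast
  qed
  have mu0: "mu m p (\<A>0 \<union> H) = mu m p \<A>0 + mu m p H"
    using sub0 sub1 HA disj by (intro mu_Un_disjoint) auto
  have mu1: "mu m p (\<A>1 - c ` H) = mu m p \<A>1 - mu m p (c ` H)"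
    using mu_Diff_subset[OF sub1 HA(2)] .
  have inj: "inj_on c H" using cc HA by (intro inj_on_inverseI[where g = c]) auto
  have light: "mu m p (c ` H) \<le> mu m p H"
    unfolding mu_def sum.reindex[OF inj] o_def
    by (intro sum_mono) (auto simp: H_def w_def)
  have p01': "\<forall>i\<in>{1..m}. 0 < p i \<and> p i < 1" using p01 by auto
  have q: "0 < ?q" using p01 by simp
  have Hsub: "H \<subseteq> Pow {1..m}" using HA sub1 by blast
  have H0: "0 \<le> mu m p H" using mu_nonneg[OF p01' Hsub] .
  have b0: "extremal_bound m p (\<A>0 \<union> H)" using sub0 Hsub by (intro IH[OF _ int0] Un_least)
  have b1: "extremal_bound m p (\<A>1 - c ` H)" using sub1 by (intro IH[OF _ int1] subset_trans[OF Diff_subset])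
  have le0: "(1 - ?q) * mu m p (\<A>0 \<union> H) \<le> (1 - ?q) * p 1"
    using b0 half by (intro mult_left_mono) (auto simp: extremal_bound_def)
  have le1: "?q * mu m p (\<A>1 - c ` H) \<le> ?q * p 1"
    using b1 q by (intro mult_left_mono) (auto simp: extremal_bound_def)
  have leH: "?q * mu m p (c ` H) \<le> ?q * mu m p H"
    using light q by (intro mult_left_mono) auto
  have gain: "0 \<le> (1 - 2 * ?q) * mu m p H" using half H0 by (intro mult_nonneg_nonneg) auto
  \<comment> \<open>The defect is split into two nonnegative terms, so that equality makes both vanish.\<close>
  have total: "mu (Suc m) p \<A> = (1 - ?q) * mu m p (\<A>0 \<union> H) + ?q * mu m p (\<A>1 - c ` H)
      - (1 - 2 * ?q) * mu m p H - (?q * mu m p H - ?q * mu m p (c ` H))"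
    using mu_Suc[OF sub, of p] unfolding mu0 mu1 \<A>0_def[symmetric] \<A>1_def[symmetric]
    by (simp add: algebra_simps)
  have split: "p 1 = (1 - ?q) * p 1 + ?q * p 1" by (simp add: algebra_simps)
  \<comment> \<open>Stars with distinct centers contain disjoint singletons, which cross-intersection excludes.\<close>
  have "\<exists>i\<in>{1..Suc m}. \<A> = star (Suc m) i" if eq: "mu (Suc m) p \<A> = p 1"
  proof -
    have "(1 - 2 * ?q) * mu m p H = 0" using total eq split le0 le1 leH gain by linarith
    then have "H = {}" using half mu_eq_0_iff[OF p01' Hsub] by simp
    have "(1 - ?q) * mu m p (\<A>0 \<union> H) = (1 - ?q) * p 1" "?q * mu m p (\<A>1 - c ` H) = ?q * p 1"
      using total eq split le0 le1 leH gain by linarith+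
    then have "mu m p \<A>0 = p 1" "mu m p \<A>1 = p 1" using half q \<open>H = {}\<close> by auto
    then obtain i l where il: "i \<in> {1..m}" "l \<in> {1..m}" "\<A>0 = star m i" "\<A>1 = star m l"
      using b0 b1 \<open>H = {}\<close> by (auto simp: extremal_bound_def)
    then have "i = l" using cross[of "{i}" "{l}"] by (auto simp: star_def)
    then have "\<A> = star (Suc m) i"
      using avoiding_Un_link[of \<A> "Suc m"] avoiding_Un_link[of "star (Suc m) i" "Suc m"]
        il star_Suc[OF il(1)] by (simp add: \<A>0_def \<A>1_def)
    then show ?thesis using il(1) by auto
  qed
  moreover have "mu (Suc m) p \<A> \<le> p 1" using total split le0 le1 leH gain by linarith
  ultimately show ?thesis by (simp add: extremal_bound_def)
qed

section \<open>The induction\<close>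

text \<open>Shifting to every smaller element need not be done in a fixed order: any effective shift
  brings \<open>\<A>\<close> closer to a compressed family, and its bound and its equality case pull back.\<close>

lemma extremal_bound_Suc:
  assumes p01: "\<forall>i\<in>{1..Suc m}. 0 < p i \<and> p i < 1"
    and last: "\<And>i. i \<in> {1..m} \<Longrightarrow> p (Suc m) \<le> p i"
    and half: "p (Suc m) < 1/2" and m: "m \<ge> 1"
    and IH: "\<And>\<B>. \<B> \<subseteq> Pow {1..m} \<Longrightarrow> intersecting \<B> \<Longrightarrow> extremal_bound m p \<B>"
  shows "intersecting \<A> \<Longrightarrow> \<A> \<subseteq> Pow {1..Suc m} \<Longrightarrow> extremal_bound (Suc m) p \<A>"
proof (induction "card {F \<in> \<A>. Suc m \<in> F}" arbitrary: \<A> rule: less_induct)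
  case less
  show ?case
  proof (cases "\<forall>i\<in>{1..m}. movable i (Suc m) \<A> = {}")
    case True
    then show ?thesis
      using compressed_extremal[OF p01 half m IH less.prems] by blast
  next
    case False
    then obtain i where i: "i \<in> {1..m}" and mov: "movable i (Suc m) \<A> \<noteq> {}" by blast
    let ?S = "shift i (Suc m) \<A>"
    have i': "i \<in> {1..Suc m}" "Suc m \<in> {1..Suc m}" "i \<noteq> Suc m" using i by auto
    have bS: "extremal_bound (Suc m) p ?S"
      by (rule less.hyps[OF card_containing_shift_less[OF finite_family[OF less.prems(2)] mov i'(3)]
            intersecting_shift[OF less.prems(1) i'(3)] shift_subset_Pow[OF less.prems(2) i'(1)]])
    have ge: "mu (Suc m) p \<A> \<le> mu (Suc m) p ?S"
      using mu_shift_ge[OF p01 i'(1,2) last[OF i] less.prems(2)] .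
    have "\<A> = star (Suc m) (Suc m)" if "mu (Suc m) p \<A> = p 1"
    proof -
      have "mu (Suc m) p ?S = p 1" using bS ge that by (simp add: extremal_bound_def)
      then obtain l where "?S = star (Suc m) l" using bS by (auto simp: extremal_bound_def)
      then show ?thesis using star_if_shift_star[OF less.prems i' mov] by blast
    qed
    then show ?thesis using bS ge i'(2) by (auto simp: extremal_bound_def)
  qed
qed

lemma intersecting_extremal_bound:
  assumes "n \<ge> 1"
    and "\<forall>i\<in>{1..n}. 0 < p i \<and> p i < 1"
    and "\<And>i j. 1 \<le> i \<Longrightarrow> i \<le> j \<Longrightarrow> j \<le> n \<Longrightarrow> p j \<le> p i"
    and "3 \<le> n \<longrightarrow> p 3 < 1/2"
    and "intersecting \<A>" "\<A> \<subseteq> Pow {1..n}"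
  shows "extremal_bound n p \<A>"
  using assms
proof (induction n arbitrary: \<A>)
  case (Suc m)
  show ?case
  proof (cases "m < 2")
    case True
    then have "Suc m = 1 \<or> Suc m = 2" by auto
    then obtain i where i: "i \<in> {1..Suc m}" "\<A> \<subseteq> star (Suc m) i"
      using intersecting_on_two_sub_star[OF Suc.prems(5,6)] by blast
    then show ?thesis using sub_star_extremal[OF Suc.prems(2)] Suc.prems(3)[of 1 i] by auto
  next
    case False
    have "p (Suc m) \<le> p 3" "p 3 < 1/2" using Suc.prems(3)[of 3 "Suc m"] Suc.prems(4) False by auto
    then have half: "p (Suc m) < 1/2" by simp
    have IH: "extremal_bound m p \<B>" if "\<B> \<subseteq> Pow {1..m}" "intersecting \<B>" for \<B>
      using Suc.IH[OF _ _ _ _ that(2,1)] Suc.prems(2,3,4) False by auto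
    show ?thesis
      using extremal_bound_Suc[OF Suc.prems(2) _ half _ IH Suc.prems(5,6)] Suc.prems(3) False by auto
  qed
next
  case 0
  show ?case using 0(1) by simp
qed

theorem theorem1:
  fixes n :: nat and p :: "nat \<Rightarrow> real" and \<A> :: "nat set set"
  assumes "n \<ge> 1"
    and "\<And>i. i \<in> {1..n} \<Longrightarrow> 0 < p i \<and> p i < 1"
    and "\<And>i j. 1 \<le> i \<Longrightarrow> i \<le> j \<Longrightarrow> j \<le> n \<Longrightarrow> p j \<le> p i"
    and "3 \<le> n \<longrightarrow> p 3 < 1/2"
    and "p 1 \<le> 1/2 \<or> (3 \<le> n \<longrightarrow> 1 - p 2 > p 3)"
    and "\<A> \<subseteq> Pow {1..n}"
    and "wise_intersecting 2 \<A>"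
  shows "mu n p \<A> \<le> p 1 \<and>
    (mu n p \<A> = p 1 \<longleftrightarrow> (\<exists>i\<in>{1..n}. p 1 = p i \<and> \<A> = star n i))"
proof -
  have "\<forall>i\<in>{1..n}. 0 < p i \<and> p i < 1" by (intro ballI assms(2))
  note bound = intersecting_extremal_bound[OF assms(1) this assms(3,4)
      intersecting_if_wise_intersecting_2[OF assms(7)] assms(6)]
  have center: "p i = p 1" if "mu n p \<A> = p 1" "i \<in> {1..n}" "\<A> = star n i" for i
    using that(1) mu_star[OF that(2), of p] unfolding that(3) by linarith
  show ?thesis
  proof (intro conjI iffI)
    show "mu n p \<A> \<le> p 1" using bound unfolding extremal_bound_def by (rule conjunct1)
  next
    assume eq: "mu n p \<A> = p 1"
    then obtain i where "i \<in> {1..n}" "\<A> = star n i"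
      using bound unfolding extremal_bound_def by blast
    then show "\<exists>i\<in>{1..n}. p 1 = p i \<and> \<A> = star n i" using center[OF eq] by metis
  next
    assume "\<exists>i\<in>{1..n}. p 1 = p i \<and> \<A> = star n i"
    then obtain i where "i \<in> {1..n}" "p 1 = p i" "\<A> = star n i" by blast
    then show "mu n p \<A> = p 1" using mu_star[of i n p] by simp
  qed
qed

end
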